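(* Let $n \ge 1$ be an integer, let $(X_1, X_2, \dots, X_n)$ be a multivariate (jointly) Gaussian real random vector with mean vector $(\mu_1, \mu_2, \dots, \mu_n)$ and $n \times n$ variance-covariance matrix $\Phi = [\varphi_{ij}]$, where $\mu_i = E\{X_i\}$ and $\varphi_{ij} = E\{X_i X_j\} - \mu_i \mu_j$, and let $\boldsymbol{a} = (a_1, a_2, \dots, a_n)$ be nonnegative integers. Then $$E\left\{ \prod_{i=1}^{n} X_i^{a_i} \right\} = \sum_{\boldsymbol{l} \in S_{\boldsymbol{a}}} d_{\boldsymbol{a},\boldsymbol{l}} \left( \prod_{i=1}^{n} \prod_{j=i}^{n} \varphi_{ij}^{l_{ij}} \right) \left( \prod_{j=1}^{n} \mu_j^{L_{\boldsymbol{a},j}} \right),$$ where, for every $\boldsymbol{l} = (l_{ij})_{1 \le i \le j \le n} \in S_{\boldsymbol{a}}$, $$d_{\boldsymbol{a},\boldsymbol{l}} = \frac{\prod_{k=1}^{n} a_k!}{2^{M_{\boldsymbol{l}}} \left( \prod_{i=1}^{n} \prod_{j=i}^{n} l_{ij}! \right) \left( \prod_{j=1}^{n} L_{\boldsymbol{a},j}! \right)}, \qquad M_{\boldsymbol{l}} = \sum_{k=1}^{n} l_{kk}.$$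
   Context: For $\boldsymbol{a} = (a_1, \dots, a_n)$ a family of nonnegative integers and $\boldsymbol{l} = (l_{ij})_{1 \le i \le j \le n}$ a family of nonnegative integers (indexed by pairs $i \le j$), extend the indexing by setting $l_{ji} = l_{ij}$, and define for $k = 1, \dots, n$ $$L_{\boldsymbol{a},k} = a_k - l_{kk} - \sum_{j=1}^{n} l_{jk}$$ (the sum includes the term $j = k$, so $l_{kk}$ is subtracted twice in total; $L_{\boldsymbol{a},k}$ depends on $\boldsymbol{l}$ as well as on $\boldsymbol{a}$). The set $S_{\boldsymbol{a}}$ is the (finite) collection of all families $\boldsymbol{l} = (l_{ij})_{1 \le i \le j \le n}$ of nonnegative integers such that $L_{\boldsymbol{a},k} \ge 0$ for all $k = 1, \dots, n$. Here $\varphi_{ij}$ is the covariance of $X_i$ and $X_j$ if $i \ne j$, and the variance of $X_i$ if $i = j$. The usual convention $x^0 = 1$ for all real $x$ (including $0^0 = 1$) is used. *)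

theory Defs
  imports "HOL-Probability.Probability"
begin

text \<open>A constant random variable counts as Gaussian (variance zero), so that singular covariance
  matrices are covered.\<close>

definition gaussian_rv :: "'a measure \<Rightarrow> ('a \<Rightarrow> real) \<Rightarrow> bool" where
  "gaussian_rv M Y \<longleftrightarrow>
     (\<exists>m \<sigma>. 0 < \<sigma> \<and> distributed M lborel Y (normal_density m \<sigma>)) \<or>
     (Y \<in> borel_measurable M \<and> (\<exists>m. AE \<omega> in M. Y \<omega> = m))"

definition jointly_gaussian :: "'a measure \<Rightarrow> nat \<Rightarrow> (nat \<Rightarrow> 'a \<Rightarrow> real) \<Rightarrow> bool" where
  "jointly_gaussian M n X \<longleftrightarrow>
     (\<forall>i\<in>{1..n}. X i \<in> borel_measurable M) \<and>
     (\<forall>c :: nat \<Rightarrow> real. gaussian_rv M (\<lambda>\<omega>. \<Sum>i=1..n. c i * X i \<omega>))"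

definition upper_pairs :: "nat \<Rightarrow> (nat \<times> nat) set" where
  "upper_pairs n = {(i, j). 1 \<le> i \<and> i \<le> j \<and> j \<le> n}"

text \<open>The families \<open>l\<close> are indexed by pairs \<open>i \<le> j\<close> only; the lookup at
  \<open>(min j k, max j k)\<close> is the symmetric extension of the indexing. The value is an integer
  because it may be negative.\<close>

definition L_exp :: "nat \<Rightarrow> (nat \<Rightarrow> nat) \<Rightarrow> (nat \<times> nat \<Rightarrow> nat) \<Rightarrow> nat \<Rightarrow> int" where
  "L_exp n a l k = int (a k) - int (l (k, k)) - (\<Sum>j=1..n. int (l (min j k, max j k)))"

text \<open>Members are extensional, i.e. fixed outside \<open>upper_pairs n\<close>, so each family on
  \<open>upper_pairs n\<close> is counted once.\<close>

definition S_set :: "nat \<Rightarrow> (nat \<Rightarrow> nat) \<Rightarrow> (nat \<times> nat \<Rightarrow> nat) set" where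
  "S_set n a = {l \<in> upper_pairs n \<rightarrow>\<^sub>E UNIV. \<forall>k\<in>{1..n}. L_exp n a l k \<ge> 0}"

definition diag_sum :: "nat \<Rightarrow> (nat \<times> nat \<Rightarrow> nat) \<Rightarrow> nat" where
  "diag_sum n l = (\<Sum>k=1..n. l (k, k))"

definition d_coeff :: "nat \<Rightarrow> (nat \<Rightarrow> nat) \<Rightarrow> (nat \<times> nat \<Rightarrow> nat) \<Rightarrow> real" where
  "d_coeff n a l = (\<Prod>k=1..n. fact (a k)) /
     (2 ^ diag_sum n l * (\<Prod>i=1..n. \<Prod>j=i..n. fact (l (i, j))) *
      (\<Prod>j=1..n. fact (nat (L_exp n a l j))))"

text \<open>Finiteness matters because a sum over an infinite set is 0 by convention.\<close>

lemma finite_S_set: "finite (S_set n a)"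
proof -
  have "upper_pairs n \<subseteq> {1..n} \<times> {1..n}"
    by (auto simp: upper_pairs_def)
  then have fin: "finite (upper_pairs n)"
    by (rule finite_subset) simp
  have "l p \<in> {..a (fst p)}" if l: "l \<in> S_set n a" and p: "p \<in> upper_pairs n" for l p
  proof -
    obtain i j where ij: "p = (i, j)" "1 \<le> i" "i \<le> j" "j \<le> n"
      using p by (auto simp: upper_pairs_def)
    have "int (l (min j i, max j i)) \<le> (\<Sum>j=1..n. int (l (min j i, max j i)))"
      using ij by (intro member_le_sum) auto
    moreover have "L_exp n a l i \<ge> 0"
      using l ij by (auto simp: S_set_def)
    ultimately show ?thesis
      using ij by (simp add: L_exp_def min_absorb2 max_absorb1)
  qed
  then have "S_set n a \<subseteq> (\<Pi>\<^sub>E p\<in>upper_pairs n. {..a (fst p)})"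
    by (force simp: S_set_def PiE_iff)
  then show ?thesis
    by (rule finite_subset) (simp add: fin finite_PiE)
qed

end

theory Submission
  imports Defs "HOL-Computational_Algebra.Polynomial"
begin

text \<open>The definition of joint Gaussianity speaks of the linear combinations
  \<open>Y = (\<Sum>i=1..n. c i * X i)\<close> only, so the mixed moments are recovered from the moments of these by
  polarization: both sides of a formula for the \<open>N\<close>-th moment of \<open>Y\<close>, with \<open>N = (\<Sum>i=1..n. a i)\<close>,
  are polynomials in the numbers \<open>c i\<close>, and the coefficients of \<open>\<Prod>i=1..n. c i ^ a i\<close> have to
  agree.

  On the one hand \<open>Y ^ N / fact N\<close> expands by the multinomial theorem (\<open>divided_multinomial\<close>), and
  the coefficient of its expectation is the wanted mixed moment divided by
  \<open>\<Prod>i=1..n. fact (a i)\<close>. On the other hand \<open>Y\<close> is Gaussian with mean \<open>m = (\<Sum>i=1..n. \<mu> i * c i)\<close>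
  and variance \<open>v = (\<Sum>i=1..n. \<Sum>j=1..n. c i * c j * \<phi> i j)\<close>, whence (\<open>gaussian_rv_moments\<close>) the
  expectation of \<open>Y ^ N / fact N\<close> is the sum of \<open>(v / 2) ^ k / fact k * (m ^ r / fact r)\<close> over all
  \<open>2 * k + r = N\<close>. Half the variance is a linear form in the products \<open>c i * c j\<close> over unordered
  pairs (\<open>half_quadratic_form\<close>), so another use of the multinomial theorem
  (\<open>pair_single_expansion\<close>) writes the sum in terms of families \<open>l\<close> of exponents for the
  covariances and \<open>\<beta>\<close> of exponents for the means. The monomial in \<open>c\<close> that belongs to
  \<open>(l, \<beta>)\<close> is \<open>\<Prod>i=1..n. c i ^ (incidence_degree n l i + \<beta> i)\<close>; it equals
  \<open>\<Prod>i=1..n. c i ^ a i\<close> exactly if \<open>l \<in> S_set n a\<close> and \<open>\<beta>\<close> is given by \<open>L_exp n a l\<close>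
  (\<open>sum_pair_single_families_degree\<close>), which yields the sum over \<open>S_set n a\<close>. Coefficients may be
  compared by \<open>multivariate_coefficients_unique\<close>.

  The mixed moments exist because each \<open>X i\<close> is itself one of the combinations \<open>Y\<close> and so has
  moments of all orders (\<open>integrable_prod_powers\<close>).\<close>

section \<open>Multinomial expansion and comparison of coefficients\<close>

text \<open>The families are extensional, so that each exponent vector on \<open>I\<close> is counted once.\<close>

definition compositions :: "'i set \<Rightarrow> nat \<Rightarrow> ('i \<Rightarrow> nat) set" where
  "compositions I N = {\<alpha> \<in> I \<rightarrow>\<^sub>E UNIV. sum \<alpha> I = N}"

lemma compositions_bound:
  assumes "finite I" shows "compositions I N \<subseteq> (I \<rightarrow>\<^sub>E {..N})"
  using assms by (auto simp: compositions_def PiE_iff extensional_def intro!: member_le_sum)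

lemma finite_compositions:
  "finite I \<Longrightarrow> finite (compositions I N)"
  by (rule finite_subset[OF compositions_bound]) (auto intro: finite_PiE)

text \<open>The multinomial theorem with both sides divided by \<open>fact N\<close>, the degree \<open>N\<close> part of
  \<open>exp (\<Sum>i\<in>I. x i) = (\<Prod>i\<in>I. exp (x i))\<close>. In this form the induction on \<open>I\<close> is a single
  application of the binomial theorem, which splits off the exponent of the new index.\<close>

lemma divided_multinomial:
  fixes x :: "'i \<Rightarrow> real"
  assumes "finite I"
  shows "(\<Sum>i\<in>I. x i) ^ N / fact N =
    (\<Sum>\<alpha>\<in>compositions I N. \<Prod>i\<in>I. x i ^ \<alpha> i / fact (\<alpha> i))"
  using assms
proof (induction I arbitrary: N)
  case empty
  then show ?case by (cases N) (auto simp: compositions_def)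
next
  case (insert b I)
  have "(\<Sum>i\<in>insert b I. x i) ^ N / fact N =
    (\<Sum>k\<le>N. x b ^ k / fact k * ((\<Sum>i\<in>I. x i) ^ (N - k) / fact (N - k)))"
    using insert.hyps
    by (simp add: binomial_ring sum_divide_distrib binomial_fact field_simps)
  also have "\<dots> = (\<Sum>k\<le>N. \<Sum>\<alpha>\<in>compositions I (N - k).
      x b ^ k / fact k * (\<Prod>i\<in>I. x i ^ \<alpha> i / fact (\<alpha> i)))"
    by (simp add: insert.IH sum_distrib_left)
  also have "\<dots> = (\<Sum>(k, \<alpha>)\<in>(SIGMA k:{..N}. compositions I (N - k)).
      x b ^ k / fact k * (\<Prod>i\<in>I. x i ^ \<alpha> i / fact (\<alpha> i)))"
    using insert.hyps by (subst sum.Sigma) (auto simp: finite_compositions)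
  also have "\<dots> = (\<Sum>\<alpha>\<in>compositions (insert b I) N. \<Prod>i\<in>insert b I. x i ^ \<alpha> i / fact (\<alpha> i))"
  proof (rule sum.reindex_bij_witness[of _ "\<lambda>\<alpha>. (\<alpha> b, restrict \<alpha> I)" "\<lambda>(k, \<alpha>). \<alpha>(b := k)"])
    fix t assume t: "t \<in> (SIGMA k:{..N}. compositions I (N - k))"
    obtain k \<alpha> where [simp]: "t = (k, \<alpha>)" by (cases t)
    have ext: "\<alpha> \<in> I \<rightarrow>\<^sub>E UNIV" and k: "k \<le> N" "sum \<alpha> I = N - k"
      using t by (auto simp: compositions_def)
    have eq: "(if i = b then k else \<alpha> i) = \<alpha> i" if "i \<in> I" for i using that insert.hyps by auto
    show "((case t of (k, \<alpha>) \<Rightarrow> \<alpha>(b := k)) b, restrict (case t of (k, \<alpha>) \<Rightarrow> \<alpha>(b := k)) I) = t"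
      using ext insert.hyps by (auto simp: fun_eq_iff PiE_iff extensional_def)
    show "(case t of (k, \<alpha>) \<Rightarrow> \<alpha>(b := k)) \<in> compositions (insert b I) N"
      using ext k insert.hyps eq by (auto simp: compositions_def PiE_iff extensional_def)
    show "(\<Prod>i\<in>insert b I. x i ^ (case t of (k, \<alpha>) \<Rightarrow> \<alpha>(b := k)) i /
            fact ((case t of (k, \<alpha>) \<Rightarrow> \<alpha>(b := k)) i)) =
         (case t of (k, \<alpha>) \<Rightarrow> x b ^ k / fact k * (\<Prod>i\<in>I. x i ^ \<alpha> i / fact (\<alpha> i)))"
      using insert.hyps eq by simp
  next
    fix \<alpha> assume a: "\<alpha> \<in> compositions (insert b I) N"
    show "(case (\<alpha> b, restrict \<alpha> I) of (k, \<alpha>) \<Rightarrow> \<alpha>(b := k)) = \<alpha>"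
      using a by (auto simp: fun_eq_iff compositions_def PiE_iff extensional_def)
    show "(\<alpha> b, restrict \<alpha> I) \<in> (SIGMA k:{..N}. compositions I (N - k))"
      using a insert.hyps by (auto simp: compositions_def)
  qed
  finally show ?case .
qed

lemma univariate_coefficients_unique:
  fixes p :: "'t \<Rightarrow> real" and q :: "'u \<Rightarrow> real"
  assumes fin: "finite T" "finite U"
    and eq: "\<And>x. (\<Sum>t\<in>T. p t * x ^ e t) = (\<Sum>u\<in>U. q u * x ^ f u)"
  shows "(\<Sum>t\<in>{t\<in>T. e t = k}. p t) = (\<Sum>u\<in>{u\<in>U. f u = k}. q u)"
proof -
  have "poly (\<Sum>t\<in>T. monom (p t) (e t)) = poly (\<Sum>u\<in>U. monom (q u) (f u))"
    using eq by (auto simp: fun_eq_iff poly_sum poly_monom)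
  then have "coeff (\<Sum>t\<in>T. monom (p t) (e t)) k = coeff (\<Sum>u\<in>U. monom (q u) (f u)) k"
    by (simp only: poly_eq_poly_eq_iff)
  then show ?thesis
    using fin by (simp add: coeff_sum sum.inter_filter)
qed

text \<open>A real polynomial function determines its coefficients. Both polynomials are given by arbitrary
  indexed families of monomials in which an exponent vector may occur several times, hence the
  coefficient of \<open>a\<close> is a sum over a fibre. This generality lets the induction on the variables
  simply pass to the indices with the right exponent at one variable.\<close>

lemma multivariate_coefficients_unique:
  fixes p :: "'t \<Rightarrow> real" and q :: "'u \<Rightarrow> real"
    and e :: "'t \<Rightarrow> 'i \<Rightarrow> nat" and f :: "'u \<Rightarrow> 'i \<Rightarrow> nat"
  assumes "finite I" "finite T" "finite U"
    and "\<And>c. (\<Sum>t\<in>T. p t * (\<Prod>i\<in>I. c i ^ e t i)) = (\<Sum>u\<in>U. q u * (\<Prod>i\<in>I. c i ^ f u i))"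
  shows "(\<Sum>t\<in>{t\<in>T. \<forall>i\<in>I. e t i = a i}. p t) = (\<Sum>u\<in>{u\<in>U. \<forall>i\<in>I. f u i = a i}. q u)"
  using assms
proof (induction I arbitrary: T U)
  case empty
  then show ?case by simp
next
  case (insert b I)
  \<comment> \<open>Only the variable at \<open>b\<close> moves, which leaves a univariate identity; what remains after
     comparing its coefficients is again an identity in the variables from \<open>I\<close>.\<close>
  have upd: "(\<Prod>i\<in>I. (c(b := x)) i ^ g i) = (\<Prod>i\<in>I. c i ^ g i)" for c :: "'i \<Rightarrow> real" and x g
    using insert.hyps by (intro prod.cong) auto
  have "(\<Sum>t\<in>{t\<in>T. e t b = a b}. p t * (\<Prod>i\<in>I. c i ^ e t i)) =
        (\<Sum>u\<in>{u\<in>U. f u b = a b}. q u * (\<Prod>i\<in>I. c i ^ f u i))" for c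
  proof (rule univariate_coefficients_unique)
    show "(\<Sum>t\<in>T. p t * (\<Prod>i\<in>I. c i ^ e t i) * x ^ e t b) =
          (\<Sum>u\<in>U. q u * (\<Prod>i\<in>I. c i ^ f u i) * x ^ f u b)" for x
      using insert.prems(3)[of "c(b := x)"] insert.hyps upd[of c x]
      by (simp add: mult_ac)
  qed (use insert.prems in auto)
  from insert.IH[OF _ _ this] insert.prems(1,2) show ?case
    by (simp add: conj_assoc)
qed

section \<open>Products and sums over unordered pairs\<close>

lemma finite_upper_pairs: "finite (upper_pairs n)"
  by (rule finite_subset[of _ "{1..n} \<times> {1..n}"]) (auto simp: upper_pairs_def)

text \<open>Passing between unordered pairs with repetition and ordered pairs: an unordered pair \<open>i < j\<close>
  covers \<open>(i, j)\<close> and \<open>(j, i)\<close>, and a pair \<open>(i, i)\<close> contributes twice on the left, whence the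
  additional diagonal factor on the right. The statement is for an arbitrary commutative monoid
  because it is needed for sums (the quadratic form, the total degree) and for products (the
  monomials).\<close>

lemma (in comm_monoid_set) upper_pairs_symmetrize:
  "F (\<lambda>(i, j). h i j \<^bold>* h j i) (upper_pairs n) =
   F (\<lambda>i. h i i \<^bold>* F (h i) {1..n}) {1..n}"
proof (induction n)
  case 0
  have "upper_pairs 0 = {}" by (auto simp: upper_pairs_def)
  then show ?case by simp
next
  case (Suc n)
  have split: "upper_pairs (Suc n) = upper_pairs n \<union> (\<lambda>i. (i, Suc n)) ` {1..Suc n}"
    by (auto simp: upper_pairs_def le_Suc_eq)
  have disj: "upper_pairs n \<inter> (\<lambda>i. (i, Suc n)) ` {1..Suc n} = {}"
    by (auto simp: upper_pairs_def)
  have "F (\<lambda>(i, j). h i j \<^bold>* h j i) (upper_pairs (Suc n)) =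
    F (\<lambda>(i, j). h i j \<^bold>* h j i) (upper_pairs n) \<^bold>*
    F (\<lambda>i. h i (Suc n) \<^bold>* h (Suc n) i) {1..Suc n}"
    unfolding split using finite_upper_pairs disj
    by (subst union_disjoint) (auto simp: reindex inj_on_def o_def)
  also have "\<dots> = F (\<lambda>i. h i i \<^bold>* F (h i) {1..Suc n}) {1..Suc n}"
    by (simp add: Suc.IH distrib ac_simps)
  finally show ?case .
qed

lemma (in comm_monoid_set) upper_pairs_nested:
  "F (\<lambda>i. F (\<lambda>j. h (i, j)) {i..n}) {1..n} = F h (upper_pairs n)"
proof -
  have "(SIGMA i:{1..n}. {i..n}) = upper_pairs n"
    by (auto simp: upper_pairs_def)
  then show ?thesis
    by (subst Sigma) auto
qed

text \<open>A family \<open>l\<close> is a multigraph with \<open>l (i, j)\<close> edges between \<open>i\<close> and \<open>j\<close>; this is the degree of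
  the vertex \<open>k\<close>, a loop counting twice.\<close>

definition incidence_degree :: "nat \<Rightarrow> (nat \<times> nat \<Rightarrow> nat) \<Rightarrow> nat \<Rightarrow> nat" where
  "incidence_degree n l k = l (k, k) + (\<Sum>j=1..n. l (min j k, max j k))"

lemma L_exp_eq: "L_exp n a l k = int (a k) - int (incidence_degree n l k)"
  by (simp add: L_exp_def incidence_degree_def)

text \<open>The handshaking lemma: every edge has two ends.\<close>

lemma sum_incidence_degree:
  "(\<Sum>k=1..n. incidence_degree n l k) = 2 * (\<Sum>p\<in>upper_pairs n. l p)"
proof -
  have "2 * (\<Sum>p\<in>upper_pairs n. l p) =
    (\<Sum>(i, j)\<in>upper_pairs n. l (min j i, max j i) + l (min i j, max i j))"
    unfolding sum_distrib_left
    by (rule sum.cong) (auto simp: upper_pairs_def min_def max_def)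
  also have "\<dots> = (\<Sum>k=1..n. incidence_degree n l k)"
    unfolding sum.upper_pairs_symmetrize by (simp add: incidence_degree_def)
  finally show ?thesis ..
qed

text \<open>The product form of double counting the ends of the edges.\<close>

lemma prod_pairs_incidence_degree:
  fixes c :: "nat \<Rightarrow> real"
  shows "(\<Prod>p\<in>upper_pairs n. (c (fst p) * c (snd p)) ^ l p) =
    (\<Prod>k=1..n. c k ^ incidence_degree n l k)"
proof -
  have "(\<Prod>p\<in>upper_pairs n. (c (fst p) * c (snd p)) ^ l p) =
    (\<Prod>(i, j)\<in>upper_pairs n. c i ^ l (min j i, max j i) * c j ^ l (min i j, max i j))"
    by (rule prod.cong) (auto simp: upper_pairs_def min_def max_def power_mult_distrib)
  also have "\<dots> = (\<Prod>k=1..n. c k ^ incidence_degree n l k)"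
    unfolding prod.upper_pairs_symmetrize
    by (simp add: incidence_degree_def power_add power_sum)
  finally show ?thesis .
qed

text \<open>The coefficients of half the quadratic form \<open>\<Sum>i j. c i * c j * \<phi> i j\<close> when it is written over
  unordered pairs: an off-diagonal term occurs twice and loses the factor one half.\<close>

definition pair_weight :: "(nat \<Rightarrow> nat \<Rightarrow> real) \<Rightarrow> nat \<times> nat \<Rightarrow> real" where
  "pair_weight \<phi> = (\<lambda>(i, j). if i = j then \<phi> i i / 2 else \<phi> i j)"

lemma half_quadratic_form:
  assumes "\<And>i j. i \<in> {1..n} \<Longrightarrow> j \<in> {1..n} \<Longrightarrow> \<phi> i j = \<phi> j i"
  shows "(\<Sum>i=1..n. \<Sum>j=1..n. c i * c j * \<phi> i j) / 2 =
    (\<Sum>p\<in>upper_pairs n. pair_weight \<phi> p * (c (fst p) * c (snd p)))"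
proof -
  \<comment> \<open>Splitting each unordered term evenly over \<open>(i, j)\<close> and \<open>(j, i)\<close> leaves a quarter of
     \<open>c i * c i * \<phi> i i\<close> at \<open>(i, i)\<close>, which the symmetrization counts twice.\<close>
  define h where "h i j = pair_weight \<phi> (i, j) * (c i * c j) / 2" for i j
  have "(\<Sum>p\<in>upper_pairs n. pair_weight \<phi> p * (c (fst p) * c (snd p))) =
    (\<Sum>(i, j)\<in>upper_pairs n. h i j + h j i)"
    using assms by (intro sum.cong) (auto simp: h_def upper_pairs_def pair_weight_def)
  also have "\<dots> = (\<Sum>i=1..n. h i i + (\<Sum>j=1..n. h i j))"
    by (rule sum.upper_pairs_symmetrize)
  also have "\<dots> = (\<Sum>i=1..n. \<Sum>j=1..n. c i * c j * \<phi> i j / 2)"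
  proof (rule sum.cong)
    fix i assume i: "i \<in> {1..n}"
    have "(\<Sum>j=1..n. c i * c j * \<phi> i j / 2) = (\<Sum>j=1..n. h i j + (if j = i then h i i else 0))"
      by (rule sum.cong) (auto simp: h_def pair_weight_def)
    then show "h i i + (\<Sum>j=1..n. h i j) = (\<Sum>j=1..n. c i * c j * \<phi> i j / 2)"
      using i by (simp add: sum.distrib)
  qed simp
  finally show ?thesis
    by (simp add: sum_divide_distrib)
qed

text \<open>The halves on the diagonal are the only source of the power of two in \<open>d_coeff\<close>.\<close>

lemma prod_pair_weight:
  "(\<Prod>p\<in>upper_pairs n. pair_weight \<phi> p ^ l p) =
    (\<Prod>i=1..n. \<Prod>j=i..n. \<phi> i j ^ l (i, j)) / 2 ^ diag_sum n l"
proof -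
  have "(\<Prod>p\<in>upper_pairs n. pair_weight \<phi> p ^ l p) =
    (\<Prod>i=1..n. \<Prod>j=i..n. pair_weight \<phi> (i, j) ^ l (i, j))"
    by (rule prod.upper_pairs_nested[symmetric])
  also have "\<dots> = (\<Prod>i=1..n. (\<Prod>j=i..n. \<phi> i j ^ l (i, j)) / 2 ^ l (i, i))"
  proof (rule prod.cong)
    fix i assume i: "i \<in> {1..n}"
    have "(\<Prod>j=i..n. pair_weight \<phi> (i, j) ^ l (i, j)) =
      (\<Prod>j=i..n. \<phi> i j ^ l (i, j) * (if j = i then 1 / 2 ^ l (i, i) else 1))"
      by (rule prod.cong) (auto simp: pair_weight_def power_divide)
    then show "(\<Prod>j=i..n. pair_weight \<phi> (i, j) ^ l (i, j)) =
      (\<Prod>j=i..n. \<phi> i j ^ l (i, j)) / 2 ^ l (i, i)"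
      using i by (simp add: prod.distrib)
  qed simp
  also have "\<dots> = (\<Prod>i=1..n. \<Prod>j=i..n. \<phi> i j ^ l (i, j)) / 2 ^ diag_sum n l"
    by (simp add: prod_dividef diag_sum_def power_sum)
  finally show ?thesis .
qed

section \<open>Expanding a univariate Gaussian moment\<close>

text \<open>The index set of the expansion of a Gaussian moment of order \<open>N\<close>: of the \<open>N\<close> factors, two are
  used up by each covariance counted in \<open>l\<close> and one by each mean counted in \<open>\<beta>\<close>.\<close>

definition pair_single_families ::
    "'p set \<Rightarrow> 'i set \<Rightarrow> nat \<Rightarrow> (('p \<Rightarrow> nat) \<times> ('i \<Rightarrow> nat)) set" where
  "pair_single_families P I N =
     {(l, \<beta>). l \<in> P \<rightarrow>\<^sub>E UNIV \<and> \<beta> \<in> I \<rightarrow>\<^sub>E UNIV \<and> 2 * sum l P + sum \<beta> I = N}"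

lemma finite_pair_single_families:
  assumes "finite P" "finite I"
  shows "finite (pair_single_families P I N)"
proof (rule finite_subset)
  show "pair_single_families P I N \<subseteq>
    (\<Union>k\<le>N. compositions P k) \<times> (\<Union>k\<le>N. compositions I k)"
    by (auto simp: pair_single_families_def compositions_def)
qed (use assms in \<open>auto simp: finite_compositions\<close>)

text \<open>With half the variance \<open>\<Sum>p\<in>P. y p\<close> and the mean \<open>\<Sum>i\<in>I. z i\<close>, the left-hand side is the
  divided moment of order \<open>N\<close> of a Gaussian variable; both powers are expanded by the multinomial
  theorem. The outer index \<open>k\<close> is recovered as the total of \<open>l\<close>.\<close>

lemma pair_single_expansion:
  fixes y :: "'p \<Rightarrow> real" and z :: "'i \<Rightarrow> real"
  assumes "finite P" "finite I"
  shows "(\<Sum>k\<le>N div 2. (\<Sum>p\<in>P. y p) ^ k / fact k *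
      ((\<Sum>i\<in>I. z i) ^ (N - 2 * k) / fact (N - 2 * k))) =
    (\<Sum>(l, \<beta>)\<in>pair_single_families P I N.
      (\<Prod>p\<in>P. y p ^ l p / fact (l p)) * (\<Prod>i\<in>I. z i ^ \<beta> i / fact (\<beta> i)))"
proof -
  let ?f = "\<lambda>(l, \<beta>). (\<Prod>p\<in>P. y p ^ l p / fact (l p)) * (\<Prod>i\<in>I. z i ^ \<beta> i / fact (\<beta> i))"
  have "(\<Sum>k\<le>N div 2. (\<Sum>p\<in>P. y p) ^ k / fact k *
      ((\<Sum>i\<in>I. z i) ^ (N - 2 * k) / fact (N - 2 * k))) =
    (\<Sum>k\<le>N div 2. \<Sum>l\<beta>\<in>compositions P k \<times> compositions I (N - 2 * k). ?f l\<beta>)"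
    using assms by (simp add: divided_multinomial sum_product sum.cartesian_product)
  also have "\<dots> = (\<Sum>(k, l\<beta>)\<in>(SIGMA k:{..N div 2}. compositions P k \<times> compositions I (N - 2 * k)).
      ?f l\<beta>)"
    using assms by (subst sum.Sigma) (auto simp: finite_compositions)
  also have "\<dots> = (\<Sum>l\<beta>\<in>pair_single_families P I N. ?f l\<beta>)"
    by (rule sum.reindex_bij_witness[of _ "\<lambda>(l, \<beta>). (sum l P, (l, \<beta>))" snd])
      (auto simp: pair_single_families_def compositions_def)
  finally show ?thesis .
qed

text \<open>Once the exponent vector of the monomial is prescribed to be \<open>a\<close>, the exponents \<open>\<beta>\<close> of the
  means are determined by \<open>l\<close>: they are the numbers \<open>L_exp n a l\<close>, and their nonnegativity is
  the condition defining \<open>S_set n a\<close>. The constraint on the total degree then holds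
  by the handshaking lemma. The congruence assumption says that \<open>g\<close> looks at \<open>\<beta>\<close>
  on \<open>{1..n}\<close> only, which allows the extensional \<open>\<beta>\<close> to be replaced by \<open>L_exp n a l\<close> itself.\<close>

lemma sum_pair_single_families_degree:
  fixes g :: "(nat \<times> nat \<Rightarrow> nat) \<Rightarrow> (nat \<Rightarrow> nat) \<Rightarrow> real"
  assumes cong: "\<And>l \<beta> \<gamma>. (\<And>i. i \<in> {1..n} \<Longrightarrow> \<beta> i = \<gamma> i) \<Longrightarrow> g l \<beta> = g l \<gamma>"
  shows "(\<Sum>(l, \<beta>)\<in>{(l, \<beta>)\<in>pair_single_families (upper_pairs n) {1..n} (\<Sum>i=1..n. a i).
      \<forall>i\<in>{1..n}. incidence_degree n l i + \<beta> i = a i}. g l \<beta>) =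
    (\<Sum>l\<in>S_set n a. g l (\<lambda>i. nat (L_exp n a l i)))"
proof (rule sum.reindex_bij_witness[of _
      "\<lambda>l. (l, restrict (\<lambda>i. nat (L_exp n a l i)) {1..n})" fst])
  fix l assume l: "l \<in> S_set n a"
  let ?\<beta> = "restrict (\<lambda>i. nat (L_exp n a l i)) {1..n}"
  have deg: "incidence_degree n l i + ?\<beta> i = a i" if "i \<in> {1..n}" for i
    using l that by (force simp: S_set_def L_exp_eq)
  have "2 * sum l (upper_pairs n) + sum ?\<beta> {1..n} =
      (\<Sum>i=1..n. incidence_degree n l i + ?\<beta> i)"
    unfolding sum.distrib sum_incidence_degree by simp
  also have "\<dots> = (\<Sum>i=1..n. a i)"
    using deg by (intro sum.cong) auto
  finally show "(l, ?\<beta>) \<in> {(l, \<beta>)\<in>pair_single_families (upper_pairs n) {1..n} (\<Sum>i=1..n. a i).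
      \<forall>i\<in>{1..n}. incidence_degree n l i + \<beta> i = a i}"
    using l deg by (simp add: pair_single_families_def S_set_def)
  show "fst (l, ?\<beta>) = l" by simp
next
  fix t assume t: "t \<in> {(l, \<beta>)\<in>pair_single_families (upper_pairs n) {1..n} (\<Sum>i=1..n. a i).
      \<forall>i\<in>{1..n}. incidence_degree n l i + \<beta> i = a i}"
  obtain l \<beta> where [simp]: "t = (l, \<beta>)" by (cases t)
  have L: "L_exp n a l i = int (\<beta> i)" if "i \<in> {1..n}" for i
    using t that by (force simp: L_exp_eq)
  have ext: "l \<in> upper_pairs n \<rightarrow>\<^sub>E UNIV" "\<beta> \<in> {1..n} \<rightarrow>\<^sub>E UNIV"
    using t by (auto simp: pair_single_families_def)
  show "(fst t, restrict (\<lambda>i. nat (L_exp n a (fst t) i)) {1..n}) = t"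
    using ext(2) L by (auto simp: fun_eq_iff PiE_iff extensional_def)
  show "fst t \<in> S_set n a"
    using ext(1) L by (simp add: S_set_def)
  show "g (fst t) (\<lambda>i. nat (L_exp n a (fst t) i)) = (case t of (l, \<beta>) \<Rightarrow> g l \<beta>)"
    using L by (auto intro: cong)
qed

text \<open>Clearing the factorials \<open>fact (a i)\<close> turns the coefficient belonging to \<open>l\<close> into the summand
  of the moment formula.\<close>

lemma pair_single_term_eq_d_coeff:
  "(\<Prod>i=1..n. fact (a i)) *
      ((\<Prod>p\<in>upper_pairs n. pair_weight \<phi> p ^ l p / fact (l p)) *
       (\<Prod>i=1..n. \<mu> i ^ nat (L_exp n a l i) / fact (nat (L_exp n a l i)))) =
    d_coeff n a l * (\<Prod>i=1..n. \<Prod>j=i..n. \<phi> i j ^ l (i, j)) *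
      (\<Prod>j=1..n. \<mu> j ^ nat (L_exp n a l j))"
  unfolding prod_dividef prod_pair_weight d_coeff_def
    prod.upper_pairs_nested[of "\<lambda>p. fact (l p)" n]
  by simp

section \<open>Integrability and univariate Gaussian moments\<close>

text \<open>The Cauchy-Schwarz situation, by the domination \<open>\<bar>x * y\<bar> \<le> x\<^sup>2 + y\<^sup>2\<close>.\<close>

lemma integrable_mult_square:
  fixes f g :: "'a \<Rightarrow> real"
  assumes "integrable M (\<lambda>\<omega>. (f \<omega>)\<^sup>2)" "integrable M (\<lambda>\<omega>. (g \<omega>)\<^sup>2)"
    and [measurable]: "f \<in> borel_measurable M" "g \<in> borel_measurable M"
  shows "integrable M (\<lambda>\<omega>. f \<omega> * g \<omega>)"
proof (rule Bochner_Integration.integrable_bound)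
  show "integrable M (\<lambda>\<omega>. (f \<omega>)\<^sup>2 + (g \<omega>)\<^sup>2)"
    using assms by simp
  have "\<bar>x * y\<bar> \<le> x\<^sup>2 + y\<^sup>2" for x y :: real
    using sum_squares_bound[of "\<bar>x\<bar>" "\<bar>y\<bar>"] abs_ge_zero[of "x * y"]
    unfolding abs_mult power2_abs by linarith
  then show "AE \<omega> in M. norm (f \<omega> * g \<omega>) \<le> norm ((f \<omega>)\<^sup>2 + (g \<omega>)\<^sup>2)"
    by simp
qed simp

text \<open>Marginal moments of all orders control the mixed ones: splitting off one variable by the
  previous lemma requires the square of the remaining product, which is a product of powers again
  with doubled exponents. Therefore the exponents are generalized in the induction.\<close>

lemma (in finite_measure) integrable_prod_powers:
  fixes X :: "'i \<Rightarrow> 'a \<Rightarrow> real"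
  assumes "finite I" "\<And>i. i \<in> I \<Longrightarrow> X i \<in> borel_measurable M"
    and "\<And>i k. i \<in> I \<Longrightarrow> integrable M (\<lambda>\<omega>. X i \<omega> ^ k)"
  shows "integrable M (\<lambda>\<omega>. \<Prod>i\<in>I. X i \<omega> ^ \<alpha> i)"
  using assms
proof (induction I arbitrary: \<alpha>)
  case empty
  then show ?case by simp
next
  case (insert b I)
  have [measurable]: "X b \<in> borel_measurable M" and "\<And>i. i \<in> I \<Longrightarrow> X i \<in> borel_measurable M"
    using insert.prems by auto
  moreover from this have "(\<lambda>\<omega>. \<Prod>i\<in>I. X i \<omega> ^ \<alpha> i) \<in> borel_measurable M"
    by (intro borel_measurable_prod borel_measurable_power) auto
  moreover have "integrable M (\<lambda>\<omega>. (\<Prod>i\<in>I. X i \<omega> ^ \<alpha> i)\<^sup>2)"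
    using insert.IH[of "\<lambda>i. \<alpha> i * 2"] insert.prems
    by (simp add: prod_power_distrib power_mult)
  moreover have "integrable M (\<lambda>\<omega>. (X b \<omega> ^ \<alpha> b)\<^sup>2)"
    using insert.prems by (simp add: power_mult[symmetric])
  ultimately show ?case
    using insert.hyps by (simp add: integrable_mult_square)
qed

text \<open>The divided central moments are the Taylor coefficients of \<open>exp (v * t\<^sup>2 / 2)\<close>. Normal and almost
  surely constant variables are covered uniformly, the latter with \<open>v = 0\<close> and \<open>0 ^ 0 = 1\<close>.\<close>

lemma gaussian_rv_central_moments:
  assumes "prob_space M" "gaussian_rv M Y"
  obtains m v where "\<And>k. has_bochner_integral M (\<lambda>\<omega>. (Y \<omega> - m) ^ k / fact k)
    (if even k then (v / 2) ^ (k div 2) / fact (k div 2) else 0)"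
proof -
  interpret prob_space M by fact
  consider (normal) m \<sigma> where "0 < \<sigma>" "distributed M lborel Y (normal_density m \<sigma>)"
    | (const) m where "Y \<in> borel_measurable M" "AE \<omega> in M. Y \<omega> = m"
    using assms(2) by (auto simp: gaussian_rv_def)
  then show thesis
  proof cases
    case normal
    have "has_bochner_integral M (\<lambda>\<omega>. (Y \<omega> - m) ^ k / fact k)
      (if even k then (\<sigma>\<^sup>2 / 2) ^ (k div 2) / fact (k div 2) else 0)" for k
    proof -
      have "has_bochner_integral lborel (\<lambda>x. normal_density m \<sigma> x * (x - m) ^ k)
        (fact k * (if even k then (\<sigma>\<^sup>2 / 2) ^ (k div 2) / fact (k div 2) else 0))"
      proof (cases "even k")
        case True
        then obtain j where "k = 2 * j" by (auto elim: evenE)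
        then show ?thesis
          using normal_moment_even[OF normal(1), of m j] by (simp add: power_divide)
      next
        case False
        then obtain j where "k = 2 * j + 1" by (auto elim: oddE)
        then show ?thesis
          using normal_moment_odd[OF normal(1), of m j] by simp
      qed
      then have "has_bochner_integral M (\<lambda>\<omega>. (Y \<omega> - m) ^ k)
        (fact k * (if even k then (\<sigma>\<^sup>2 / 2) ^ (k div 2) / fact (k div 2) else 0))"
        using distributed_integrable[OF normal(2), of "\<lambda>x. (x - m) ^ k"]
          distributed_integral[OF normal(2), of "\<lambda>x. (x - m) ^ k"]
        by (simp add: has_bochner_integral_iff)
      from has_bochner_integral_divide_zero[OF this, of "fact k"] show ?thesis by simp
    qed
    then show thesis by (rule that)
  next
    case const
    have "has_bochner_integral M (\<lambda>\<omega>. (Y \<omega> - m) ^ k / fact k)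
      (if even k then (0 / 2) ^ (k div 2) / fact (k div 2) else 0)" for k
    proof -
      have "AE \<omega> in M. (Y \<omega> - m) ^ k / fact k = 0 ^ k / fact k"
        using const(2) by eventually_elim simp
      moreover have "has_bochner_integral M (\<lambda>\<omega>. 0 ^ k / fact k :: real) (0 ^ k / fact k)"
        by (simp add: has_bochner_integral_iff prob_space)
      ultimately have "has_bochner_integral M (\<lambda>\<omega>. (Y \<omega> - m) ^ k / fact k) (0 ^ k / fact k)"
        using const(1) by (subst has_bochner_integral_cong_AE) auto
      then show ?thesis
        by (cases "k = 0") (auto simp: power_0_left elim!: evenE)
    qed
    then show thesis by (rule that)
  qed
qed

text \<open>The Taylor coefficients of the moment generating function \<open>exp (m * t + v * t\<^sup>2 / 2)\<close>, obtained
  from the central moments by the binomial theorem applied to \<open>(Y - m) + m\<close>. The parameters are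
  expressed by the first two moments of \<open>Y\<close>, because for a linear combination of jointly Gaussian
  variables those are computed from \<open>\<mu>\<close> and \<open>\<phi>\<close>.\<close>

lemma gaussian_rv_moments:
  assumes "prob_space M" "gaussian_rv M Y"
  defines "m \<equiv> (\<integral>\<omega>. Y \<omega> \<partial>M)"
  defines "v \<equiv> (\<integral>\<omega>. (Y \<omega>)\<^sup>2 \<partial>M) - m\<^sup>2"
  shows "integrable M (\<lambda>\<omega>. Y \<omega> ^ N)"
    and "(\<integral>\<omega>. Y \<omega> ^ N \<partial>M) / fact N =
      (\<Sum>k\<le>N div 2. (v / 2) ^ k / fact k * (m ^ (N - 2 * k) / fact (N - 2 * k)))"
proof -
  interpret prob_space M by fact
  obtain m' v' where central: "\<And>k. has_bochner_integral M (\<lambda>\<omega>. (Y \<omega> - m') ^ k / fact k)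
    (if even k then (v' / 2) ^ (k div 2) / fact (k div 2) else 0)"
    using gaussian_rv_central_moments[OF assms(1,2)] by blast
  have moment: "has_bochner_integral M (\<lambda>\<omega>. Y \<omega> ^ N / fact N)
    (\<Sum>k\<le>N div 2. (v' / 2) ^ k / fact k * (m' ^ (N - 2 * k) / fact (N - 2 * k)))" for N
  proof -
    have "Y \<omega> ^ N / fact N =
      (\<Sum>k\<le>N. (Y \<omega> - m') ^ k / fact k * (m' ^ (N - k) / fact (N - k)))" for \<omega>
      using binomial_ring[of "Y \<omega> - m'" m' N]
      by (simp add: sum_divide_distrib binomial_fact field_simps)
    moreover have "has_bochner_integral M
        (\<lambda>\<omega>. \<Sum>k\<le>N. (Y \<omega> - m') ^ k / fact k * (m' ^ (N - k) / fact (N - k)))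
        (\<Sum>k\<le>N. (if even k then (v' / 2) ^ (k div 2) / fact (k div 2) else 0) *
          (m' ^ (N - k) / fact (N - k)))"
      by (intro has_bochner_integral_sum has_bochner_integral_mult_left central)
    moreover have "(\<Sum>k\<le>N. (if even k then (v' / 2) ^ (k div 2) / fact (k div 2) else 0) *
          (m' ^ (N - k) / fact (N - k))) =
        (\<Sum>k\<le>N div 2. (v' / 2) ^ k / fact k * (m' ^ (N - 2 * k) / fact (N - 2 * k)))"
    proof -
      have "(\<Sum>k\<le>N. (if even k then (v' / 2) ^ (k div 2) / fact (k div 2) else 0) *
          (m' ^ (N - k) / fact (N - k))) =
        (\<Sum>k\<in>{k\<in>{..N}. even k}. (v' / 2) ^ (k div 2) / fact (k div 2) *
          (m' ^ (N - k) / fact (N - k)))"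
        by (subst sum.inter_filter) (auto intro!: sum.cong)
      also have "\<dots> = (\<Sum>k\<le>N div 2. (v' / 2) ^ k / fact k * (m' ^ (N - 2 * k) / fact (N - 2 * k)))"
        by (rule sum.reindex_bij_witness[of _ "\<lambda>k. 2 * k" "\<lambda>k. k div 2"]) auto
      finally show ?thesis .
    qed
    ultimately show ?thesis by simp
  qed
  \<comment> \<open>The formula at orders 1 and 2 identifies the two parameters as mean and variance.\<close>
  have m: "m = m'"
    using has_bochner_integral_integral_eq[OF moment[of 1]] by (simp add: m_def)
  have two: "{..Suc 0} = {0, 1}" by auto
  have "(\<integral>\<omega>. (Y \<omega>)\<^sup>2 \<partial>M) / 2 = m'\<^sup>2 / 2 + v' / 2"
    using has_bochner_integral_integral_eq[OF moment[of 2]] by (simp add: two)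
  then have v: "v = v'"
    using m by (simp add: v_def)
  show "integrable M (\<lambda>\<omega>. Y \<omega> ^ N)"
    using has_bochner_integral_mult_left[OF moment[of N], of "fact N"]
    by (simp add: has_bochner_integral_iff)
  show "(\<integral>\<omega>. Y \<omega> ^ N \<partial>M) / fact N =
      (\<Sum>k\<le>N div 2. (v / 2) ^ k / fact k * (m ^ (N - 2 * k) / fact (N - 2 * k)))"
    using has_bochner_integral_integral_eq[OF moment[of N]] by (simp add: m v)
qed

section \<open>Moments of a jointly Gaussian vector\<close>

theorem theorem1:
  fixes M :: "'a measure" and n :: nat and X :: "nat \<Rightarrow> 'a \<Rightarrow> real"
    and \<mu> :: "nat \<Rightarrow> real" and \<phi> :: "nat \<Rightarrow> nat \<Rightarrow> real" and a :: "nat \<Rightarrow> nat"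
  assumes "prob_space M"
    and "n \<ge> 1"
    and "jointly_gaussian M n X"
    and "\<And>i. i \<in> {1..n} \<Longrightarrow> \<mu> i = prob_space.expectation M (X i)"
    and "\<And>i j. i \<in> {1..n} \<Longrightarrow> j \<in> {1..n} \<Longrightarrow>
           \<phi> i j = prob_space.expectation M (\<lambda>\<omega>. X i \<omega> * X j \<omega>) - \<mu> i * \<mu> j"
  shows "integrable M (\<lambda>\<omega>. \<Prod>i=1..n. X i \<omega> ^ a i) \<and>
    prob_space.expectation M (\<lambda>\<omega>. \<Prod>i=1..n. X i \<omega> ^ a i) =
      (\<Sum>l\<in>S_set n a. d_coeff n a l * (\<Prod>i=1..n. \<Prod>j=i..n. \<phi> i j ^ l (i, j)) *
         (\<Prod>j=1..n. \<mu> j ^ nat (L_exp n a l j)))"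
proof -
  interpret prob_space M by fact
  have gauss: "gaussian_rv M (\<lambda>\<omega>. \<Sum>i=1..n. c i * X i \<omega>)" for c
    using assms(3) by (auto simp: jointly_gaussian_def)
  have meas: "X i \<in> borel_measurable M" if "i \<in> {1..n}" for i
    using assms(3) that by (auto simp: jointly_gaussian_def)
  have pow: "integrable M (\<lambda>\<omega>. X i \<omega> ^ k)" if "i \<in> {1..n}" for i k
  proof -
    have "(\<Sum>j=1..n. (if j = i then 1 else 0) * X j \<omega>) = X i \<omega>" for \<omega>
      using that by (simp add: if_distrib[of "\<lambda>x. x * _"] cong: if_cong)
    then show ?thesis
      using gaussian_rv_moments(1)[OF assms(1) gauss[of "\<lambda>j. if j = i then 1 else 0"], of k] by simp
  qed
  have int: "integrable M (\<lambda>\<omega>. \<Prod>i=1..n. X i \<omega> ^ \<alpha> i)" for \<alpha>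
    by (rule integrable_prod_powers) (use meas pow in auto)
  have int1: "integrable M (X i)" if "i \<in> {1..n}" for i
    using pow[OF that, of 1] by simp
  have int2: "integrable M (\<lambda>\<omega>. X i \<omega> * X j \<omega>)" if "i \<in> {1..n}" "j \<in> {1..n}" for i j
    using meas pow that by (intro integrable_mult_square) auto
  have second: "expectation (\<lambda>\<omega>. X i \<omega> * X j \<omega>) = \<phi> i j + \<mu> i * \<mu> j"
    if "i \<in> {1..n}" "j \<in> {1..n}" for i j
    using assms(5)[OF that] by simp
  have sym: "\<phi> i j = \<phi> j i" if "i \<in> {1..n}" "j \<in> {1..n}" for i j
    using assms(5) that by (simp add: mult.commute)

  have mean: "expectation (\<lambda>\<omega>. \<Sum>i=1..n. c i * X i \<omega>) = (\<Sum>i=1..n. \<mu> i * c i)" for c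
    using int1 assms(4) by (simp add: Bochner_Integration.integral_sum mult.commute)
  have var: "(expectation (\<lambda>\<omega>. (\<Sum>i=1..n. c i * X i \<omega>)\<^sup>2) - (\<Sum>i=1..n. \<mu> i * c i)\<^sup>2) / 2 =
      (\<Sum>p\<in>upper_pairs n. pair_weight \<phi> p * (c (fst p) * c (snd p)))" for c
  proof -
    have "expectation (\<lambda>\<omega>. (\<Sum>i=1..n. c i * X i \<omega>)\<^sup>2) =
        expectation (\<lambda>\<omega>. \<Sum>i=1..n. \<Sum>j=1..n. (c i * c j) * (X i \<omega> * X j \<omega>))"
      by (simp add: power2_eq_square sum_product mult_ac)
    also have "\<dots> = (\<Sum>i=1..n. \<Sum>j=1..n. (c i * c j) * expectation (\<lambda>\<omega>. X i \<omega> * X j \<omega>))"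
      using int2 by (subst Bochner_Integration.integral_sum) (auto intro!: sum.cong)
    also have "\<dots> - (\<Sum>i=1..n. \<mu> i * c i)\<^sup>2 = (\<Sum>i=1..n. \<Sum>j=1..n. c i * c j * \<phi> i j)"
      unfolding power2_eq_square sum_product sum_subtractf[symmetric]
      using second by (intro sum.cong) (auto simp: algebra_simps)
    finally show ?thesis
      using half_quadratic_form[of n \<phi> c] sym by simp
  qed

  \<comment> \<open>The coefficient of \<open>c ^ a\<close> lives in the homogeneous part of degree \<open>N\<close>, so only the
     \<open>N\<close>-th moment of the linear combinations is needed.\<close>
  define N where "N = (\<Sum>i=1..n. a i)"
  let ?I = "{1..n}" and ?P = "upper_pairs n"
  define p where "p \<alpha> = expectation (\<lambda>\<omega>. \<Prod>i=1..n. X i \<omega> ^ \<alpha> i) / (\<Prod>i=1..n. fact (\<alpha> i))" for \<alpha>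
  define g where "g l \<beta> = (\<Prod>p\<in>?P. pair_weight \<phi> p ^ l p / fact (l p)) *
      (\<Prod>i=1..n. \<mu> i ^ \<beta> i / fact (\<beta> i))" for l and \<beta> :: "nat \<Rightarrow> nat"
  have "(\<Sum>\<alpha>\<in>compositions ?I N. p \<alpha> * (\<Prod>i=1..n. c i ^ \<alpha> i)) =
    (\<Sum>t\<in>pair_single_families ?P ?I N. (case t of (l, \<beta>) \<Rightarrow> g l \<beta>) *
      (\<Prod>i=1..n. c i ^ (case t of (l, \<beta>) \<Rightarrow> \<lambda>i. incidence_degree n l i + \<beta> i) i))" for c
  proof -
    have "(\<Sum>\<alpha>\<in>compositions ?I N. p \<alpha> * (\<Prod>i=1..n. c i ^ \<alpha> i)) =
      expectation (\<lambda>\<omega>. \<Sum>\<alpha>\<in>compositions ?I N. \<Prod>i=1..n. (c i * X i \<omega>) ^ \<alpha> i / fact (\<alpha> i))"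
      using int
      by (simp add: Bochner_Integration.integral_sum p_def power_mult_distrib prod.distrib prod_dividef mult_ac)
    also have "\<dots> = expectation (\<lambda>\<omega>. (\<Sum>i=1..n. c i * X i \<omega>) ^ N) / fact N"
      by (simp add: divided_multinomial[symmetric])
    also have "\<dots> = (\<Sum>k\<le>N div 2.
        (\<Sum>p\<in>?P. pair_weight \<phi> p * (c (fst p) * c (snd p))) ^ k / fact k *
        ((\<Sum>i=1..n. \<mu> i * c i) ^ (N - 2 * k) / fact (N - 2 * k)))"
      unfolding gaussian_rv_moments(2)[OF assms(1) gauss] mean var ..
    also have "\<dots> = (\<Sum>(l, \<beta>)\<in>pair_single_families ?P ?I N.
        (\<Prod>p\<in>?P. (pair_weight \<phi> p * (c (fst p) * c (snd p))) ^ l p / fact (l p)) *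
        (\<Prod>i=1..n. (\<mu> i * c i) ^ \<beta> i / fact (\<beta> i)))"
      by (rule pair_single_expansion) (simp_all add: finite_upper_pairs)
    also have "\<dots> = (\<Sum>(l, \<beta>)\<in>pair_single_families ?P ?I N. g l \<beta> *
        ((\<Prod>p\<in>?P. (c (fst p) * c (snd p)) ^ l p) * (\<Prod>i=1..n. c i ^ \<beta> i)))"
      by (simp only: g_def power_mult_distrib[of "pair_weight _ _"] power_mult_distrib[of "\<mu> _"]
          prod.distrib prod_dividef times_divide_eq_left times_divide_eq_right mult_ac divide_divide_eq_left)
    also have "\<dots> = (\<Sum>t\<in>pair_single_families ?P ?I N. (case t of (l, \<beta>) \<Rightarrow> g l \<beta>) *
      (\<Prod>i=1..n. c i ^ (case t of (l, \<beta>) \<Rightarrow> \<lambda>i. incidence_degree n l i + \<beta> i) i))"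
      by (rule sum.cong) (auto simp: prod_pairs_incidence_degree power_add prod.distrib)
    finally show ?thesis .
  qed
  \<comment> \<open>Both sides are polynomials in \<open>c\<close>; the comparison is at the exponent vector \<open>a\<close>.\<close>
  from multivariate_coefficients_unique[OF _ _ _ this, of a]
  have coeff: "(\<Sum>\<alpha>\<in>{\<alpha>\<in>compositions ?I N. \<forall>i\<in>?I. \<alpha> i = a i}. p \<alpha>) =
    (\<Sum>t\<in>{t\<in>pair_single_families ?P ?I N.
      \<forall>i\<in>?I. (case t of (l, \<beta>) \<Rightarrow> \<lambda>i. incidence_degree n l i + \<beta> i) i = a i}.
      case t of (l, \<beta>) \<Rightarrow> g l \<beta>)"
    by (simp add: finite_compositions finite_pair_single_families finite_upper_pairs)
  have "{\<alpha>\<in>compositions ?I N. \<forall>i\<in>?I. \<alpha> i = a i} = {restrict a ?I}"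
    by (auto simp: compositions_def N_def fun_eq_iff PiE_iff extensional_def)
  moreover have "p (restrict a ?I) = p a"
    by (simp add: p_def)
  moreover have "{t\<in>pair_single_families ?P ?I N.
      \<forall>i\<in>?I. (case t of (l, \<beta>) \<Rightarrow> \<lambda>i. incidence_degree n l i + \<beta> i) i = a i} =
    {(l, \<beta>)\<in>pair_single_families ?P ?I N. \<forall>i\<in>?I. incidence_degree n l i + \<beta> i = a i}"
    by auto
  moreover have "(\<Sum>(l, \<beta>)\<in>{(l, \<beta>)\<in>pair_single_families ?P ?I N.
      \<forall>i\<in>?I. incidence_degree n l i + \<beta> i = a i}. g l \<beta>) =
    (\<Sum>l\<in>S_set n a. g l (\<lambda>i. nat (L_exp n a l i)))"
    unfolding N_def by (rule sum_pair_single_families_degree) (simp add: g_def)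
  ultimately have "p a = (\<Sum>l\<in>S_set n a. g l (\<lambda>i. nat (L_exp n a l i)))"
    using coeff by simp
  then have "expectation (\<lambda>\<omega>. \<Prod>i=1..n. X i \<omega> ^ a i) =
      (\<Sum>l\<in>S_set n a. (\<Prod>i=1..n. fact (a i)) * g l (\<lambda>i. nat (L_exp n a l i)))"
    by (simp add: p_def sum_distrib_left[symmetric] field_simps)
  also have "\<dots> = (\<Sum>l\<in>S_set n a. d_coeff n a l * (\<Prod>i=1..n. \<Prod>j=i..n. \<phi> i j ^ l (i, j)) *
         (\<Prod>j=1..n. \<mu> j ^ nat (L_exp n a l j)))"
    unfolding g_def by (intro sum.cong refl pair_single_term_eq_d_coeff)
  finally show ?thesis
    using int by simp
qed

end
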